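(* Let $P_\theta=\mathcal{N}(\theta,\sigma^2I_d)$ for $\theta\in\Theta=\mathbb{R}^d$, with $\sigma^2>0$ known. Let $X_1,\dots,X_n$ be i.i.d. from $P_{\theta_0}$, $\theta_0\in\mathbb{R}^d$, and assume adversarial contamination: one observes $\tilde X_1,\dots,\tilde X_n$ with $\tilde X_i=X_i$ for $i\notin\mathcal{O}$ and $\tilde X_i$ arbitrary for $i\in\mathcal{O}$, where $|\mathcal{O}|\le\varepsilon n$. Let $\tilde\theta_n$ be the MMD estimator computed from $\tilde X_1,\dots,\tilde X_n$ with the Gaussian kernel $k_\gamma(x,y)=\exp(-\|x-y\|^2/\gamma^2)$, $\gamma>0$. Then for any $\delta\in(0,1)$, with probability at least $1-\delta$, $$\|\tilde\theta_n-\theta_0\|^2\le-(4\sigma^2+\gamma^2)\log\left\{1-8\,e^{\frac{2\sigma^2d}{\gamma^2}}\left(\varepsilon+\frac{1+\sqrt{2\log(1/\delta)}}{\sqrt n}\right)^2\right\}.$$ In particular, the choice $\gamma=\sigma\sqrt{2d}$ leads to $$\|\tilde\theta_n-\theta_0\|^2\le-2\sigma^2(d+2)\log\left[1-8e\left(\varepsilon+\frac{1+\sqrt{2\log(1/\delta)}}{\sqrt n}\right)^2\right].$$ Here $-\log u$ is interpreted as $+\infty$ when $u\le0$.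
   Context: $\|\cdot\|$ is the Euclidean norm on $\mathbb{R}^d$. With $\mathcal{H}$ the RKHS of $k_\gamma$ and $\mu_P=\mathbb{E}_{X\sim P}[k_\gamma(X,\cdot)]$, the maximum mean discrepancy is $\mathbb{D}_{k_\gamma}(P,Q)=\|\mu_P-\mu_Q\|_{\mathcal{H}}$. The MMD estimator $\tilde\theta_n$ is a minimizer over $\theta\in\Theta$ of $\mathbb{D}_{k_\gamma}\left(P_\theta,\frac1n\sum_{i=1}^n\delta_{\tilde X_i}\right)$. The set $\mathcal{O}\subseteq\{1,\dots,n\}$ and the values $\tilde X_i$, $i\in\mathcal{O}$, are arbitrary. *)

theory Defs
  imports "HOL-Probability.Probability"
begin

text \<open>
  The isotropic Gaussian distribution \<open>N(\<theta>, s\<^sup>2 I)\<close> on \<open>real ^ 'd\<close>, with standard deviation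
  \<open>s > 0\<close> in each coordinate.
\<close>

definition gaussian :: "real \<Rightarrow> real ^ 'd \<Rightarrow> (real ^ 'd) measure" where
  "gaussian s \<theta> = density lborel (\<lambda>x. ennreal
     (exp (- (norm (x - \<theta>))\<^sup>2 / (2 * s\<^sup>2)) / sqrt (2 * pi * s\<^sup>2) ^ CARD('d)))"

definition gauss_kernel :: "real \<Rightarrow> 'a::real_normed_vector \<Rightarrow> 'a \<Rightarrow> real" where
  "gauss_kernel \<gamma> x y = exp (- (norm (x - y))\<^sup>2 / \<gamma>\<^sup>2)"

text \<open>
  The empirical measure \<open>(1/n) \<Sum>\<^sub>i \<delta>\<^bsub>x i\<^esub>\<close>, \<open>1 \<le> i \<le> n\<close>, as the image of the uniform
  distribution on the indices, so that repeated points are counted with multiplicity.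
\<close>

definition empirical :: "nat \<Rightarrow> (nat \<Rightarrow> 'a::topological_space) \<Rightarrow> 'a measure" where
  "empirical n x = distr (uniform_count_measure {1..n}) borel x"

lemma emeasure_empirical:
  assumes "n \<ge> 1" and "A \<in> sets borel"
  shows "emeasure (empirical n x) A = (\<Sum>i=1..n. emeasure (return borel (x i)) A) / of_nat n"
proof -
  have "emeasure (empirical n x) A
      = emeasure (uniform_count_measure {1..n}) (x -` A \<inter> {1..n})"
    using assms unfolding empirical_def
    by (subst emeasure_distr)
       (auto simp: space_uniform_count_measure measurable_def sets_uniform_count_measure)
  also have "\<dots> = ennreal (real (card (x -` A \<inter> {1..n})) / real n)"
    by (subst emeasure_uniform_count_measure) auto
  also have "\<dots> = of_nat (card (x -` A \<inter> {1..n})) / of_nat n"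
    using assms by (simp add: divide_ennreal[symmetric] ennreal_of_nat_eq_real_of_nat)
  also have "of_nat (card (x -` A \<inter> {1..n})) = (\<Sum>i=1..n. indicator A (x i) :: ennreal)"
    by (simp add: indicator_def sum.If_cases vimage_def Int_def conj_commute)
  finally show ?thesis
    using assms by simp
qed

text \<open>
  The Hilbert space is given as a type \<open>'h\<close> whose elements are read as real functions on
  \<open>'a\<close> through the injective linear map \<open>\<iota>\<close>. It is the reproducing kernel Hilbert space of
  \<open>k\<close> if it contains every \<open>k x\<close>, that is \<open>k(x,\<cdot>)\<close>, and evaluation at \<open>x\<close> is the inner product
  with it. Completeness comes from the sort of \<open>'h\<close>. The sort constraint
  \<open>second_countable_topology\<close> is what the library's Bochner integral asks for; it excludes
  nothing for a continuous kernel on a separable space, whose RKHS is always separable.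
\<close>

definition is_rkhs :: "('a \<Rightarrow> 'a \<Rightarrow> real)
    \<Rightarrow> ('h::{real_inner, banach, second_countable_topology} \<Rightarrow> 'a \<Rightarrow> real) \<Rightarrow> bool" where
  "is_rkhs k \<iota> \<longleftrightarrow>
     inj \<iota>
   \<and> (\<forall>f g x. \<iota> (f + g) x = \<iota> f x + \<iota> g x)
   \<and> (\<forall>c f x. \<iota> (c *\<^sub>R f) x = c * \<iota> f x)
   \<and> (\<forall>x. k x \<in> range \<iota>)
   \<and> (\<forall>f x. \<iota> f x = inner f (inv \<iota> (k x)))"

text \<open>The Bochner integral of \<open>k(X,\<cdot>)\<close> in the RKHS, for \<open>X\<close> distributed as \<open>P\<close>.\<close>

definition mean_embedding :: "('a \<Rightarrow> 'a \<Rightarrow> real)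
    \<Rightarrow> ('h::{real_inner, banach, second_countable_topology} \<Rightarrow> 'a \<Rightarrow> real)
    \<Rightarrow> 'a measure \<Rightarrow> 'h" where
  "mean_embedding k \<iota> P = integral\<^sup>L P (\<lambda>x. inv \<iota> (k x))"

definition mmd :: "('a \<Rightarrow> 'a \<Rightarrow> real)
    \<Rightarrow> ('h::{real_inner, banach, second_countable_topology} \<Rightarrow> 'a \<Rightarrow> real)
    \<Rightarrow> 'a measure \<Rightarrow> 'a measure \<Rightarrow> real" where
  "mmd k \<iota> P Q = norm (mean_embedding k \<iota> P - mean_embedding k \<iota> Q)"

text \<open>\<open>\<theta>\<close> is a value of the MMD estimator, over the parameter set \<open>\<Theta>\<close> of the model \<open>P\<close>, at the
  sample \<open>x 1, \<dots>, x n\<close>. Minimizers need not be unique.\<close>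

definition is_mmd_estimate :: "('a::topological_space \<Rightarrow> 'a \<Rightarrow> real)
    \<Rightarrow> ('h::{real_inner, banach, second_countable_topology} \<Rightarrow> 'a \<Rightarrow> real)
    \<Rightarrow> ('t \<Rightarrow> 'a measure) \<Rightarrow> 't set \<Rightarrow> nat \<Rightarrow> (nat \<Rightarrow> 'a) \<Rightarrow> 't \<Rightarrow> bool" where
  "is_mmd_estimate k \<iota> P \<Theta> n x \<theta> \<longleftrightarrow>
     is_arg_min (\<lambda>t. mmd k \<iota> (P t) (empirical n x)) (\<lambda>t. t \<in> \<Theta>) \<theta>"

text \<open>\<open>- log u\<close>, with the value \<open>+\<infinity>\<close> for \<open>u \<le> 0\<close>.\<close>

definition neg_log :: "real \<Rightarrow> ereal" where
  "neg_log u = (if u \<le> 0 then \<infinity> else ereal (- ln u))"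

end

theory Submission
  imports Defs
begin

text \<open>
  For Gaussians the squared MMD equals \<open>2 c (1 - exp (- \<parallel>\<theta> - \<theta>'\<parallel>\<^sup>2 / (4\<sigma>\<^sup>2 + \<gamma>\<^sup>2)))\<close> with
  \<open>c = (1 + 4\<sigma>\<^sup>2/\<gamma>\<^sup>2) powr (-d/2) \<ge> exp (- 2\<sigma>\<^sup>2 d / \<gamma>\<^sup>2)\<close>, so it suffices to bound the MMD between
  the estimate and the truth. By minimality this is at most twice the MMD between the contaminated
  sample and the truth, which splits into a contamination part of order \<open>\<epsilon>\<close> and the deviation of
  the clean empirical embedding from its mean. The deviation is controlled by a dimension-free
  Hoeffding inequality in Hilbert space: for centred \<open>Y\<close> with \<open>\<parallel>Y\<parallel> \<le> B\<close>, convexity of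
  \<open>u \<mapsto> cosh (sqrt u)\<close> gives \<open>E cosh \<parallel>s + Y\<parallel> \<le> cosh \<parallel>s\<parallel> cosh B\<close>, and this bound multiplies up
  along an independent sum.
\<close>

section \<open>Convexity and growth of the hyperbolic cosine\<close>

text \<open>Induction on the exponent: the inductive step loses
  \<open>(1 - t) * t * ((u - v) * (u ^ n - v ^ n))\<close>, which is nonnegative because both
  differences have the same sign.\<close>

lemma power_convex_combination:
  fixes t u v :: real
  assumes "0 \<le> t" "t \<le> 1" "0 \<le> u" "0 \<le> v"
  shows "((1 - t) * u + t * v) ^ n \<le> (1 - t) * u ^ n + t * v ^ n"
proof (induction n)
  case (Suc n)
  have "((1 - t) * u + t * v) ^ Suc n \<le> ((1 - t) * u + t * v) * ((1 - t) * u ^ n + t * v ^ n)"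
    using Suc assms by (auto intro!: mult_left_mono)
  also have "\<dots> = (1 - t) * u ^ Suc n + t * v ^ Suc n - (1 - t) * t * ((u - v) * (u ^ n - v ^ n))"
    by (simp add: algebra_simps)
  also have "\<dots> \<le> (1 - t) * u ^ Suc n + t * v ^ Suc n"
  proof -
    have "0 \<le> (u - v) * (u ^ n - v ^ n)"
      using assms power_mono[of u v n] power_mono[of v u n]
      by (cases "u \<le> v") (auto simp: zero_le_mult_iff)
    thus ?thesis using assms by (simp add: mult_nonneg_nonneg)
  qed
  finally show ?case .
qed simp

text \<open>Only even powers occur in the series of \<open>cosh\<close>, so
  \<open>cosh (sqrt u)\<close> is a power series in \<open>u\<close> with nonnegative coefficients,
  and convexity holds term by term.\<close>

lemma convex_on_cosh_sqrt: "convex_on {0..} (\<lambda>u::real. cosh (sqrt u))"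
proof (rule convex_onI)
  fix t u v :: real
  assume t: "0 < t" "t < 1" and uv: "u \<in> {0..}" "v \<in> {0..}"
  let ?c = "\<lambda>x n. if even n then x ^ n /\<^sub>R fact n else (0::real)"
  let ?w = "(1 - t) * u + t * v"
  have pow: "sqrt x ^ n = x ^ (n div 2)" if "even n" "0 \<le> x" for x :: real and n
    using that by (elim evenE) (simp add: power_mult)
  have w: "0 \<le> ?w" using t uv by auto
  have "cosh (sqrt ?w) \<le> (1 - t) * cosh (sqrt u) + t * cosh (sqrt v)"
  proof (rule sums_le)
    show "?c (sqrt ?w) sums cosh (sqrt ?w)" by (rule cosh_converges)
    show "(\<lambda>n. (1 - t) * ?c (sqrt u) n + t * ?c (sqrt v) n)
        sums ((1 - t) * cosh (sqrt u) + t * cosh (sqrt v))"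
      by (intro sums_add sums_mult cosh_converges)
    show "?c (sqrt ?w) n \<le> (1 - t) * ?c (sqrt u) n + t * ?c (sqrt v) n" for n
    proof (cases "even n")
      case True
      have "?w ^ (n div 2) / fact n \<le> ((1 - t) * u ^ (n div 2) + t * v ^ (n div 2)) / fact n"
        using t uv by (intro divide_right_mono power_convex_combination) auto
      thus ?thesis using True uv w by (simp add: pow field_simps)
    qed simp
  qed
  thus "cosh (sqrt ((1 - t) *\<^sub>R u + t *\<^sub>R v)) \<le> (1 - t) * cosh (sqrt u) + t * cosh (sqrt v)"
    by simp
qed simp

text \<open>This is Hoeffding's lemma for a symmetric two-point variable: the auxiliary inequality
  is taken with success probability \<open>1 / 2\<close> and argument \<open>2 * x\<close>.\<close>

lemma cosh_le_exp_half_square: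
  fixes x :: real
  assumes "0 \<le> x"
  shows "cosh x \<le> exp (x\<^sup>2 / 2)"
proof -
  have eq: "1 + 1 / 2 * (exp (2 * x) - 1) = exp x * cosh x"
    by (simp add: cosh_def exp_minus field_simps flip: exp_add)
  have "-(2 * x) * (1 / 2) + ln (1 + 1 / 2 * (exp (2 * x) - 1)) \<le> (2 * x)\<^sup>2 / 8"
    using assms by (intro Hoeffdings_lemma_aux) auto
  hence "ln (cosh x) \<le> x\<^sup>2 / 2"
    unfolding eq by (simp add: ln_mult power2_eq_square)
  thus ?thesis
    by (simp flip: ln_le_cancel_iff)
qed

text \<open>The chord of \<open>u \<mapsto> cosh (sqrt u)\<close> between \<open>(norm s - B)\<^sup>2\<close> and \<open>(norm s + B)\<^sup>2\<close>; it is affine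
  in \<open>s \<bullet> y\<close>, so that its correction term vanishes when \<open>y\<close> is averaged to zero.\<close>

lemma cosh_norm_add_le:
  fixes s y :: "'h::real_inner"
  assumes "norm y \<le> B" "0 < B"
  shows "cosh (norm (s + y))
      \<le> cosh (norm s) * cosh B + (sinh (norm s) * sinh B / (norm s * B)) * (s \<bullet> y)"
proof (cases "s = 0")
  case True
  \<comment> \<open>The quotient has denominator 0 here and so is 0 by convention; what remains is
    \<open>cosh (norm y) \<le> cosh B\<close>.\<close>
  thus ?thesis using assms by (simp add: cosh_real_nonneg_le_iff)
next
  case False
  define a where "a = norm s"
  \<comment> \<open>The weight for which the convex combination of \<open>(a - B)\<^sup>2\<close>
    and \<open>(a + B)\<^sup>2\<close> is
    \<open>a\<^sup>2 + 2 * (s \<bullet> y) + B\<^sup>2\<close>; Cauchy-Schwarz puts it in the unit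
    interval.\<close>
  define t where "t = (1 + (s \<bullet> y) / (a * B)) / 2"
  have a: "0 < a" using False by (simp add: a_def)
  have "\<bar>s \<bullet> y\<bar> \<le> a * norm y" unfolding a_def by (rule Cauchy_Schwarz_ineq2)
  also have "\<dots> \<le> a * B" using assms a by auto
  finally have p: "\<bar>s \<bullet> y\<bar> \<le> a * B" .
  have "\<bar>(s \<bullet> y) / (a * B)\<bar> \<le> 1" using p a assms by (simp add: abs_mult)
  hence "(s \<bullet> y) / (a * B) \<le> 1" "- ((s \<bullet> y) / (a * B)) \<le> 1"
    by (simp_all only: abs_le_iff)
  hence t: "0 \<le> t" "t \<le> 1" by (simp_all add: t_def)
  have w: "(1 - t) * (a - B)\<^sup>2 + t * (a + B)\<^sup>2 = a\<^sup>2 + 2 * (s \<bullet> y) + B\<^sup>2"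
    using a assms by (simp add: t_def field_simps power2_eq_square)
  have "(norm (s + y))\<^sup>2 = a\<^sup>2 + 2 * (s \<bullet> y) + (norm y)\<^sup>2"
    by (simp add: a_def power2_norm_eq_inner inner_add inner_commute)
  also have "\<dots> \<le> a\<^sup>2 + 2 * (s \<bullet> y) + B\<^sup>2"
    using assms by (auto intro: power_mono)
  finally have le: "norm (s + y) \<le> sqrt (a\<^sup>2 + 2 * (s \<bullet> y) + B\<^sup>2)"
    by (rule real_le_rsqrt)
  hence "cosh (norm (s + y)) \<le> cosh (sqrt (a\<^sup>2 + 2 * (s \<bullet> y) + B\<^sup>2))"
    by (subst cosh_real_nonneg_le_iff) (rule norm_ge_zero order_trans[OF norm_ge_zero le])+
  also have "\<dots> \<le> (1 - t) * cosh (sqrt ((a - B)\<^sup>2)) + t * cosh (sqrt ((a + B)\<^sup>2))"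
    using convex_onD[OF convex_on_cosh_sqrt t, of "(a - B)\<^sup>2" "(a + B)\<^sup>2"] w by simp
  also have "\<dots> = (1 - t) * cosh (a - B) + t * cosh (a + B)"
    by simp
  also have "\<dots> = cosh a * cosh B + (2 * t - 1) * (sinh a * sinh B)"
    by (simp add: cosh_add cosh_diff algebra_simps)
  also have "2 * t - 1 = (s \<bullet> y) / (a * B)" by (simp add: t_def add_divide_distrib)
  finally show ?thesis by (simp add: a_def mult_ac)
qed

section \<open>Hoeffding's inequality in Hilbert space\<close>

lemma (in prob_space) integrable_bounded:
  fixes f :: "'a \<Rightarrow> 'h::{banach, second_countable_topology}"
  assumes "f \<in> borel_measurable M" "\<And>x. norm (f x) \<le> B"
  shows "integrable M f"
  using assms by (intro integrable_const_bound[of _ B]) auto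

text \<open>Integrate the affine bound of \<open>cosh_norm_add_le\<close>: its linear term has
  expectation \<open>c * (s \<bullet> 0) = 0\<close>.\<close>

lemma (in prob_space) nn_integral_cosh_norm_add_le:
  fixes f :: "'a \<Rightarrow> 'h::{real_inner, banach, second_countable_topology}"
  assumes f[measurable]: "f \<in> borel_measurable M" and bd: "\<And>x. norm (f x) \<le> B" and B: "0 < B"
    and mean: "expectation f = 0"
  shows "(\<integral>\<^sup>+x. ennreal (cosh (norm (s + f x))) \<partial>M) \<le> ennreal (cosh (norm s) * cosh B)"
proof -
  define c where "c = sinh (norm s) * sinh B / (norm s * B)"
  have int: "integrable M f" by (rule integrable_bounded[OF f bd])
  have *: "cosh (norm (s + f x)) \<le> cosh (norm s) * cosh B + c * (s \<bullet> f x)" for x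
    unfolding c_def using cosh_norm_add_le bd B by blast
  have "(\<integral>\<^sup>+x. ennreal (cosh (norm (s + f x))) \<partial>M)
      \<le> (\<integral>\<^sup>+x. ennreal (cosh (norm s) * cosh B + c * (s \<bullet> f x)) \<partial>M)"
    by (intro nn_integral_mono ennreal_leI *)
  \<comment> \<open>The affine majorant is nonnegative because it dominates \<open>cosh\<close>, so
    its nonnegative integral is the ordinary one.\<close>
  also have "\<dots> = ennreal (\<integral>x. cosh (norm s) * cosh B + c * (s \<bullet> f x) \<partial>M)"
    using int by (intro nn_integral_eq_integral) (auto intro: order_trans[OF cosh_real_nonneg *])
  also have "(\<integral>x. cosh (norm s) * cosh B + c * (s \<bullet> f x) \<partial>M) = cosh (norm s) * cosh B"
    using int by (subst Bochner_Integration.integral_add) (auto simp: mean prob_space)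
  finally show ?thesis .
qed

text \<open>Induction on \<open>I\<close>: the new coordinate is integrated first, with the sum over
  the old coordinates in the role of the fixed vector \<open>s\<close>, which splits off one factor
  \<open>cosh B\<close>.\<close>

lemma (in prob_space) nn_integral_cosh_norm_sum_le:
  fixes f :: "'a \<Rightarrow> 'h::{real_inner, banach, second_countable_topology}"
  assumes f[measurable]: "f \<in> borel_measurable M" and bd: "\<And>x. norm (f x) \<le> B" and B: "0 < B"
    and mean: "expectation f = 0" and "finite I"
  shows "(\<integral>\<^sup>+x. ennreal (cosh (norm (\<Sum>i\<in>I. f (x i)))) \<partial>PiM I (\<lambda>_. M))
      \<le> ennreal (cosh B ^ card I)"
  using \<open>finite I\<close>
proof (induction I)
  case empty
  then show ?case by (simp add: PiM_empty nn_integral_count_space_finite)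
next
  case (insert i I)
  interpret P: product_prob_space "\<lambda>_. M" I by standard
  let ?F = "\<lambda>J x. ennreal (cosh (norm (\<Sum>i\<in>J. f (x i))))"
  have cosh_meas: "(cosh :: real \<Rightarrow> real) \<in> borel_measurable borel"
    by (intro borel_measurable_continuous_onI continuous_intros)
  have meas: "?F J \<in> borel_measurable (PiM J (\<lambda>_. M))" for J
    by (intro measurable_compose[OF _ measurable_ennreal] measurable_compose[OF _ cosh_meas]) measurable
  have "integral\<^sup>N (PiM (insert i I) (\<lambda>_. M)) (?F (insert i I))
      = (\<integral>\<^sup>+x. (\<integral>\<^sup>+y. ?F (insert i I) (x(i := y)) \<partial>M) \<partial>PiM I (\<lambda>_. M))"
    by (rule P.product_nn_integral_insert[OF insert.hyps meas])
  also have "\<dots> = (\<integral>\<^sup>+x. (\<integral>\<^sup>+y. ennreal (cosh (norm ((\<Sum>i\<in>I. f (x i)) + f y))) \<partial>M) \<partial>PiM I (\<lambda>_. M))"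
  proof -
    have "(\<Sum>j\<in>insert i I. f ((x(i := y)) j)) = (\<Sum>i\<in>I. f (x i)) + f y" for x y
    proof -
      have "(\<Sum>j\<in>I. f ((x(i := y)) j)) = (\<Sum>i\<in>I. f (x i))"
        using insert.hyps by (intro sum.cong) auto
      thus ?thesis using insert.hyps by (simp add: add.commute)
    qed
    thus ?thesis by simp
  qed
  also have "\<dots> \<le> (\<integral>\<^sup>+x. ennreal (cosh (norm (\<Sum>i\<in>I. f (x i))) * cosh B) \<partial>PiM I (\<lambda>_. M))"
    by (intro nn_integral_mono nn_integral_cosh_norm_add_le f bd B mean)
  also have "\<dots> = (\<integral>\<^sup>+x. ?F I x \<partial>PiM I (\<lambda>_. M)) * ennreal (cosh B)"
    using meas[of I] by (simp add: ennreal_mult nn_integral_multc)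
  also have "\<dots> \<le> ennreal (cosh B ^ card I) * ennreal (cosh B)"
    by (intro mult_right_mono insert.IH) auto
  also have "\<dots> = ennreal (cosh B ^ card (insert i I))"
    using insert.hyps by (simp add: ennreal_mult mult.commute)
  finally show ?case .
qed

text \<open>Chernoff's method with \<open>cosh\<close> of the scaled norm in place of an
  exponential; the factor 2 comes from \<open>exp u / 2 \<le> cosh u\<close>.\<close>

lemma (in prob_space) Hilbert_space_Hoeffding:
  fixes f :: "'b \<Rightarrow> 'h::{real_inner, banach, second_countable_topology}"
  assumes fin: "finite I" "I \<noteq> {}"
    and X: "indep_vars (\<lambda>_. N) X I" "\<And>i. i \<in> I \<Longrightarrow> distr M N (X i) = D"
    and f: "f \<in> borel_measurable N" and bd: "\<And>x. norm (f x) \<le> B" and B: "0 < B"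
    and mean: "integral\<^sup>L D f = 0" and t: "0 < t"
  shows "prob {\<omega>\<in>space M. t \<le> norm (\<Sum>i\<in>I. f (X i \<omega>))} \<le> 2 * exp (- t\<^sup>2 / (2 * real (card I) * B\<^sup>2))"
proof -
  define m where "m = real (card I)"
  have m: "0 < m" using fin by (auto simp: m_def card_gt_0_iff)
  \<comment> \<open>The minimizer of the final exponent
    \<open>m * ((l * B)\<^sup>2 / 2) - l * t\<close> over \<open>l\<close>.\<close>
  define l where "l = t / (m * B\<^sup>2)"
  have l: "0 < l" using t m B by (simp add: l_def)
  have Xm[measurable]: "X i \<in> measurable M N" if "i \<in> I" for i
    using X that by (auto simp: indep_vars_def)
  obtain j where j: "j \<in> I" using fin by auto
  have D: "prob_space D" using prob_space_distr[OF Xm[OF j]] X(2)[OF j] by simp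
  have sD[measurable_cong]: "sets D = sets N" using X(2)[OF j] sets_distr by metis
  interpret D: prob_space D by (rule D)
  define g where "g = (\<lambda>x. l *\<^sub>R f x)"
  have f'[measurable]: "f \<in> borel_measurable D" using f by measurable
  have gm[measurable]: "g \<in> borel_measurable D" by (simp add: g_def)
  have cosh_meas: "(cosh :: real \<Rightarrow> real) \<in> borel_measurable borel"
    by (intro borel_measurable_continuous_onI continuous_intros)
  let ?S = "\<lambda>x. cosh (norm (\<Sum>i\<in>I. g (x i)))"
  let ?S' = "\<lambda>\<omega>. cosh (norm (\<Sum>i\<in>I. g (X i \<omega>)))"
  have Sm: "?S \<in> borel_measurable (PiM I (\<lambda>_. D))"
    by (intro measurable_compose[OF _ cosh_meas]) measurable
  have [measurable]: "(\<lambda>\<omega>. f (X i \<omega>)) \<in> borel_measurable M" if "i \<in> I" for i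
    using Xm[OF that] f by (rule measurable_compose)
  \<comment> \<open>Independence enters here: the joint law of the sample is the product of its
    marginals, so the moment bound on \<open>PiM\<close> applies.\<close>
  have "distr M (PiM I (\<lambda>_. N)) (\<lambda>\<omega>. \<lambda>i\<in>I. X i \<omega>) = PiM I (\<lambda>i. distr M N (X i))"
    using X(1) indep_vars_iff_distr_eq_PiM'[OF fin(2) Xm] by simp
  also have "\<dots> = PiM I (\<lambda>_. D)" by (intro PiM_cong) (auto simp: X)
  finally have distr: "distr M (PiM I (\<lambda>_. N)) (\<lambda>\<omega>. \<lambda>i\<in>I. X i \<omega>) = PiM I (\<lambda>_. D)" .
  have Sm': "?S \<in> borel_measurable (PiM I (\<lambda>_. N))"
    using Sm by (simp add: measurable_cong_sets[OF sets_PiM_cong[OF refl sD] refl])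
  have bdg: "norm (g x) \<le> l * B" for x
    using bd[of x] l by (simp add: g_def)
  have lB: "0 < l * B" using l B by simp
  have "(\<integral>\<^sup>+\<omega>. ennreal (?S' \<omega>) \<partial>M) = (\<integral>\<^sup>+x. ennreal (?S x) \<partial>PiM I (\<lambda>_. D))"
    unfolding distr[symmetric] using Sm' by (subst nn_integral_distr) (auto intro!: measurable_restrict Xm)
  also have "\<dots> \<le> ennreal (cosh (l * B) ^ card I)"
    using f' by (intro D.nn_integral_cosh_norm_sum_le bdg lB fin gm) (auto simp: g_def mean)
  also have "\<dots> \<le> ennreal (exp ((l * B)\<^sup>2 / 2) ^ card I)"
    using lB by (intro ennreal_leI power_mono cosh_le_exp_half_square) (auto simp: cosh_real_nonneg)
  also have "exp ((l * B)\<^sup>2 / 2) ^ card I = exp (m * ((l * B)\<^sup>2 / 2))"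
    unfolding m_def by (rule exp_of_nat_mult[symmetric])
  finally have E: "(\<integral>\<^sup>+\<omega>. ennreal (?S' \<omega>) \<partial>M) \<le> ennreal (exp (m * ((l * B)\<^sup>2 / 2)))" .
  let ?A = "{\<omega>\<in>space M. t \<le> norm (\<Sum>i\<in>I. f (X i \<omega>))}"
  have half: "exp (l * t) / 2 \<le> ?S' \<omega>" if "\<omega> \<in> ?A" for \<omega>
  proof -
    have "l * t \<le> norm (\<Sum>i\<in>I. g (X i \<omega>))"
      using that l by (simp add: g_def flip: scaleR_sum_right)
    hence "cosh (l * t) \<le> ?S' \<omega>" using l t by (subst cosh_real_nonneg_le_iff) auto
    thus ?thesis by (simp add: cosh_def)  (smt (verit) exp_gt_zero)
  qed
  have A: "?A \<in> sets M" by measurable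
  have "ennreal (exp (l * t) / 2) * emeasure M ?A = (\<integral>\<^sup>+\<omega>. ennreal (exp (l * t) / 2) * indicator ?A \<omega> \<partial>M)"
    using A by (simp add: nn_integral_cmult_indicator)
  also have "\<dots> \<le> (\<integral>\<^sup>+\<omega>. ennreal (?S' \<omega>) \<partial>M)"
    using half by (intro nn_integral_mono) (auto simp: indicator_def intro!: ennreal_leI)
  also note E
  finally have "exp (l * t) / 2 * prob ?A \<le> exp (m * ((l * B)\<^sup>2 / 2))"
    by (simp add: emeasure_eq_measure flip: ennreal_mult)
  hence "prob ?A \<le> 2 * exp (m * ((l * B)\<^sup>2 / 2)) / exp (l * t)"
    by (simp add: pos_le_divide_eq mult.commute)
  also have "\<dots> = 2 * exp (m * ((l * B)\<^sup>2 / 2) - l * t)"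
    by (simp add: exp_diff)
  also have "m * ((l * B)\<^sup>2 / 2) - l * t = - t\<^sup>2 / (2 * m * B\<^sup>2)"
    using m B by (simp add: l_def field_simps power2_eq_square)
  finally show ?thesis by (simp add: m_def)
qed

section \<open>Gaussian integrals\<close>

text \<open>The squared norm is a sum over coordinates, so the density is a product of
  one-dimensional normal densities and the integral factorizes.\<close>

lemma nn_integral_gauss_density:
  fixes m :: "real ^ 'd"
  assumes s: "0 < s"
  shows "(\<integral>\<^sup>+x. ennreal (exp (- (norm (x - m))\<^sup>2 / (2 * s\<^sup>2)) / sqrt (2 * pi * s\<^sup>2) ^ CARD('d)) \<partial>lborel) = 1"
proof -
  have eq: "exp (- (norm (x - m))\<^sup>2 / (2 * s\<^sup>2)) / sqrt (2 * pi * s\<^sup>2) ^ CARD('d)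
      = (\<Prod>b\<in>Basis. normal_density (m \<bullet> b) s (x \<bullet> b))" for x :: "real ^ 'd"
  proof -
    have "(\<Prod>b\<in>Basis. normal_density (m \<bullet> b) s (x \<bullet> b))
        = exp (\<Sum>b\<in>Basis. - ((x - m) \<bullet> b)\<^sup>2 / (2 * s\<^sup>2)) / sqrt (2 * pi * s\<^sup>2) ^ DIM(real ^ 'd)"
      by (simp add: normal_density_def prod_dividef exp_sum inner_diff_left)
    also have "(\<Sum>b\<in>Basis. - ((x - m) \<bullet> b)\<^sup>2 / (2 * s\<^sup>2)) = - (norm (x - m))\<^sup>2 / (2 * s\<^sup>2)"
      unfolding power2_norm_eq_inner euclidean_inner[of "x - m" "x - m"]
      by (simp add: sum_negf power2_eq_square flip: sum_divide_distrib)
    finally show ?thesis by simp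
  qed
  have one: "(\<integral>\<^sup>+x. ennreal (normal_density \<mu> s x) \<partial>lborel) = 1" for \<mu>
    using s by (subst nn_integral_eq_integral) auto
  show ?thesis
    unfolding eq using s
    by (subst prod_ennreal[symmetric])
      (simp_all add: nn_integral_lborel_prod[of "\<lambda>b. normal_density (m \<bullet> b) s"] one)
qed

lemma sets_gaussian [measurable_cong, simp]: "sets (gaussian s m) = sets borel"
  by (simp add: gaussian_def)

lemma space_gaussian [simp]: "space (gaussian s m) = UNIV"
  by (simp add: gaussian_def)

lemma prob_space_gaussian: "0 < s \<Longrightarrow> prob_space (gaussian s m)"
  using nn_integral_gauss_density[of s m]
  by (intro prob_spaceI) (simp add: gaussian_def emeasure_density)

text \<open>Completing the square: the product of the kernel and the density is a multiple of the
  density of \<open>gaussian \<tau> c\<close>.\<close>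

lemma integral_gauss_kernel_gaussian:
  fixes m x :: "real ^ 'd"
  assumes s: "0 < s" and g: "0 < g"
  shows "(\<integral>y. gauss_kernel g y x \<partial>gaussian s m)
      = sqrt (g\<^sup>2 / (g\<^sup>2 + 2 * s\<^sup>2)) ^ CARD('d) * gauss_kernel (sqrt (g\<^sup>2 + 2 * s\<^sup>2)) x m"
proof -
  define h where "h = g\<^sup>2 + 2 * s\<^sup>2"
  \<comment> \<open>Precisions add: \<open>2 / g\<^sup>2\<close> from the kernel and
    \<open>1 / s\<^sup>2\<close> from the density give variance
    \<open>\<tau>\<^sup>2 = s\<^sup>2 * g\<^sup>2 / h\<close>, and \<open>c\<close> is the
    precision-weighted mean of \<open>x\<close> and \<open>m\<close>. The factor free of
    \<open>y\<close> is \<open>C\<close>.\<close>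
  define \<tau> where "\<tau> = s * g / sqrt h"
  define c where "c = (2 * s\<^sup>2 / h) *\<^sub>R x + (g\<^sup>2 / h) *\<^sub>R m"
  define C where "C = sqrt (g\<^sup>2 / h) ^ CARD('d) * exp (- (norm (x - m))\<^sup>2 / h)"
  have h: "0 < h" using s g by (simp add: h_def add_pos_pos)
  have \<tau>: "0 < \<tau>" using s g h by (simp add: \<tau>_def)
  have \<tau>2: "\<tau>\<^sup>2 = s\<^sup>2 * g\<^sup>2 / h" using h by (simp add: \<tau>_def power_divide power_mult_distrib)
  let ?d = "\<lambda>s m (y::real ^ 'd). exp (- (norm (y - m))\<^sup>2 / (2 * s\<^sup>2)) / sqrt (2 * pi * s\<^sup>2) ^ CARD('d)"
  have sq: "(norm (y - x))\<^sup>2 / g\<^sup>2 + (norm (y - m))\<^sup>2 / (2 * s\<^sup>2)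
      = (norm (y - c))\<^sup>2 / (2 * \<tau>\<^sup>2) + (norm (x - m))\<^sup>2 / h" for y
  proof -
    have hc: "h *\<^sub>R (y - c) = (2 * s\<^sup>2) *\<^sub>R (y - x) + g\<^sup>2 *\<^sub>R (y - m)"
    proof -
      have "h *\<^sub>R c = (2 * s\<^sup>2) *\<^sub>R x + g\<^sup>2 *\<^sub>R m"
        using h by (simp add: c_def scaleR_add_right)
      thus ?thesis by (simp add: h_def scaleR_diff_right scaleR_add_left)
    qed
    have xm: "x - m = (y - m) - (y - x)" by simp
    have "h\<^sup>2 * (norm (y - c))\<^sup>2 = (norm (h *\<^sub>R (y - c)))\<^sup>2"
      by (simp add: power_mult_distrib)
    also have "\<dots> = (2 * s\<^sup>2)\<^sup>2 * (norm (y - x))\<^sup>2 + (g\<^sup>2)\<^sup>2 * (norm (y - m))\<^sup>2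
        + 2 * (2 * s\<^sup>2) * g\<^sup>2 * ((y - x) \<bullet> (y - m))"
      unfolding hc power2_norm_eq_inner inner_add by (simp add: inner_commute algebra_simps power2_eq_square)
    finally have 1: "(norm (y - c))\<^sup>2 = ((2 * s\<^sup>2)\<^sup>2 * (norm (y - x))\<^sup>2 + (g\<^sup>2)\<^sup>2 * (norm (y - m))\<^sup>2
        + 2 * (2 * s\<^sup>2) * g\<^sup>2 * ((y - x) \<bullet> (y - m))) / h\<^sup>2"
      using h by (simp add: field_simps)
    have 2: "(norm (x - m))\<^sup>2 = (norm (y - m))\<^sup>2 + (norm (y - x))\<^sup>2 - 2 * ((y - x) \<bullet> (y - m))"
      unfolding xm power2_norm_eq_inner by (simp add: inner_diff inner_commute)
    \<comment> \<open>In these scalars the claim is a rational identity, settled by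
      \<open>h = G + S\<close> and the factorization of the numerator through
      \<open>h\<close>.\<close>
    define A B I where "A = (norm (y - x))\<^sup>2" and "B = (norm (y - m))\<^sup>2" and "I = (y - x) \<bullet> (y - m)"
    define S G where "S = 2 * s\<^sup>2" and "G = g\<^sup>2"
    have SG: "0 < S" "0 < G" "h = G + S" using s g by (auto simp: S_def G_def h_def)
    have "(norm (y - c))\<^sup>2 / (2 * \<tau>\<^sup>2) + (norm (x - m))\<^sup>2 / h
       = ((S\<^sup>2 * A + G\<^sup>2 * B + 2 * S * G * I) / h\<^sup>2) / (S * G / h) + (B + A - 2 * I) / h"
      unfolding 1 2 \<tau>2 A_def B_def I_def S_def G_def by simp
    also have "\<dots> = (S\<^sup>2 * A + G\<^sup>2 * B + 2 * S * G * I + S * G * (B + A - 2 * I)) / (h * (S * G))"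
    proof -
      have "P / h\<^sup>2 / (S * G / h) + Q / h = (P + S * G * Q) / (h * (S * G))" for P Q
        using SG(1,2) h by (simp add: power2_eq_square add_divide_distrib)
      thus ?thesis .
    qed
    also have "S\<^sup>2 * A + G\<^sup>2 * B + 2 * S * G * I + S * G * (B + A - 2 * I) = h * (S * A + G * B)"
      by (simp add: SG(3) algebra_simps power2_eq_square)
    also have "h * (S * A + G * B) / (h * (S * G)) = A / G + B / S"
      using SG h by (simp add: add_divide_distrib)
    finally show ?thesis by (simp add: A_def B_def G_def S_def)
  qed
  have const: "1 / sqrt (2 * pi * s\<^sup>2) = sqrt (g\<^sup>2 / h) / sqrt (2 * pi * \<tau>\<^sup>2)"
    using s g h by (simp add: \<tau>2 real_sqrt_divide real_sqrt_mult field_simps)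
  have prod: "gauss_kernel g y x * ?d s m y = C * ?d \<tau> c y" for y
  proof -
    have "gauss_kernel g y x * ?d s m y
      = exp (- ((norm (y - x))\<^sup>2 / g\<^sup>2 + (norm (y - m))\<^sup>2 / (2 * s\<^sup>2))) * (1 / sqrt (2 * pi * s\<^sup>2)) ^ CARD('d)"
      by (simp add: gauss_kernel_def exp_add[symmetric] power_one_over field_simps)
    also have "\<dots> = C * ?d \<tau> c y"
      unfolding sq const C_def by (simp add: exp_add[symmetric] power_divide field_simps)
    finally show ?thesis .
  qed
  have km: "(\<lambda>y. gauss_kernel g y x) \<in> borel_measurable borel"
    unfolding gauss_kernel_def by measurable
  have "(\<integral>y. gauss_kernel g y x \<partial>gaussian s m) = enn2real (\<integral>\<^sup>+y. ennreal (gauss_kernel g y x) \<partial>gaussian s m)"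
    using km by (intro integral_eq_nn_integral) (auto simp: gauss_kernel_def)
  also have "(\<integral>\<^sup>+y. ennreal (gauss_kernel g y x) \<partial>gaussian s m)
      = (\<integral>\<^sup>+y. ennreal (?d s m y) * ennreal (gauss_kernel g y x) \<partial>lborel)"
    unfolding gaussian_def using km by (subst nn_integral_density) auto
  also have "\<dots> = (\<integral>\<^sup>+y. ennreal C * ennreal (?d \<tau> c y) \<partial>lborel)"
  proof (intro nn_integral_cong)
    fix y
    have "ennreal (?d s m y) * ennreal (gauss_kernel g y x) = ennreal (gauss_kernel g y x * ?d s m y)"
      by (subst ennreal_mult) (auto simp: gauss_kernel_def mult.commute)
    thus "ennreal (?d s m y) * ennreal (gauss_kernel g y x) = ennreal C * ennreal (?d \<tau> c y)"
      unfolding prod by (subst (asm) ennreal_mult) (use h in \<open>auto simp: C_def\<close>)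
  qed
  also have "\<dots> = ennreal C"
    using nn_integral_gauss_density[OF \<tau>, of c] by (subst nn_integral_cmult) auto
  finally show ?thesis using h by (simp add: C_def gauss_kernel_def h_def)
qed

section \<open>Feature map, mean embeddings and the MMD between Gaussians\<close>

context
  fixes \<iota> :: "'h::{real_inner, banach, second_countable_topology} \<Rightarrow> real ^ 'd \<Rightarrow> real" and \<gamma> :: real
  assumes rkhs: "is_rkhs (gauss_kernel \<gamma>) \<iota>"
begin

text \<open>The reproducing property applied to the feature of \<open>x\<close> itself.\<close>

lemma inner_feature: "inv \<iota> (gauss_kernel \<gamma> x) \<bullet> inv \<iota> (gauss_kernel \<gamma> y) = gauss_kernel \<gamma> x y"
proof -
  have "\<iota> (inv \<iota> (gauss_kernel \<gamma> x)) y = inv \<iota> (gauss_kernel \<gamma> x) \<bullet> inv \<iota> (gauss_kernel \<gamma> y)"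
    and "gauss_kernel \<gamma> x \<in> range \<iota>"
    using rkhs unfolding is_rkhs_def by auto
  thus ?thesis by (simp add: f_inv_into_f)
qed

lemma norm_feature: "norm (inv \<iota> (gauss_kernel \<gamma> x)) = 1"
  by (simp add: norm_eq_sqrt_inner inner_feature gauss_kernel_def)

lemma norm_feature_diff:
  "(norm (inv \<iota> (gauss_kernel \<gamma> x) - inv \<iota> (gauss_kernel \<gamma> y)))\<^sup>2 = 2 - 2 * gauss_kernel \<gamma> x y"
proof -
  have "gauss_kernel \<gamma> y x = gauss_kernel \<gamma> x y" "gauss_kernel \<gamma> z z = 1" for z :: "real ^ 'd"
    by (auto simp: gauss_kernel_def norm_minus_commute)
  thus ?thesis by (simp add: power2_norm_eq_inner inner_diff inner_feature)
qed

text \<open>The feature map is continuous: the distance of two features is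
  \<open>sqrt (2 - 2 * k)\<close>, and the kernel value \<open>k\<close> tends to 1 as the points
  merge.\<close>

lemma borel_measurable_feature [measurable]: "(\<lambda>x. inv \<iota> (gauss_kernel \<gamma> x)) \<in> borel_measurable borel"
proof (intro borel_measurable_continuous_onI)
  let ?\<phi> = "\<lambda>x. inv \<iota> (gauss_kernel \<gamma> x)"
  have "(?\<phi> \<longlongrightarrow> ?\<phi> a) (at a)" for a
  proof (rule LIM_zero_cancel, rule tendsto_norm_zero_cancel)
    have "((\<lambda>x. sqrt (2 - 2 * gauss_kernel \<gamma> x a)) \<longlongrightarrow> sqrt (2 - 2 * gauss_kernel \<gamma> a a)) (at a)"
      unfolding gauss_kernel_def divide_inverse by (intro tendsto_intros)
    moreover have "norm (?\<phi> x - ?\<phi> a) = sqrt (2 - 2 * gauss_kernel \<gamma> x a)" for x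
      using norm_feature_diff[of x a] by (metis norm_ge_zero real_sqrt_unique)
    ultimately show "((\<lambda>x. norm (?\<phi> x - ?\<phi> a)) \<longlongrightarrow> 0) (at a)"
      by (simp add: gauss_kernel_def)
  qed
  thus "continuous_on UNIV ?\<phi>" by (simp add: continuous_on_def)
qed

lemma integrable_feature:
  assumes "0 < s"
  shows "integrable (gaussian s m) (\<lambda>x. inv \<iota> (gauss_kernel \<gamma> x))"
proof -
  interpret prob_space "gaussian s m" by (rule prob_space_gaussian[OF assms])
  show ?thesis by (rule integrable_const_bound[of _ 1]) (auto simp: norm_feature)
qed

text \<open>Moving the inner product inside the Bochner integral turns it into the expectation of
  the kernel.\<close>

lemma mean_embedding_inner:
  assumes "0 < s" "0 < \<gamma>"
  shows "mean_embedding (gauss_kernel \<gamma>) \<iota> (gaussian s m) \<bullet> inv \<iota> (gauss_kernel \<gamma> x)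
    = sqrt (\<gamma>\<^sup>2 / (\<gamma>\<^sup>2 + 2 * s\<^sup>2)) ^ CARD('d) * gauss_kernel (sqrt (\<gamma>\<^sup>2 + 2 * s\<^sup>2)) x m"
proof -
  have "inv \<iota> (gauss_kernel \<gamma> x) \<noteq> 0" using norm_feature[of x] by auto
  hence "mean_embedding (gauss_kernel \<gamma>) \<iota> (gaussian s m) \<bullet> inv \<iota> (gauss_kernel \<gamma> x)
     = (\<integral>y. gauss_kernel \<gamma> y x \<partial>gaussian s m)"
    unfolding mean_embedding_def
    by (subst integral_inner_left[symmetric]) (auto simp: integrable_feature assms inner_feature)
  thus ?thesis by (simp add: integral_gauss_kernel_gaussian assms)
qed

text \<open>Each of the two integrations adds \<open>2 * s\<^sup>2\<close> to the squared bandwidth,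
  and the intermediate bandwidth \<open>h\<close> cancels between the two normalizing
  factors.\<close>

lemma mean_embedding_inner_mean_embedding:
  assumes "0 < s" "0 < \<gamma>"
  shows "mean_embedding (gauss_kernel \<gamma>) \<iota> (gaussian s m) \<bullet> mean_embedding (gauss_kernel \<gamma>) \<iota> (gaussian s m')
    = sqrt (\<gamma>\<^sup>2 / (\<gamma>\<^sup>2 + 4 * s\<^sup>2)) ^ CARD('d) * exp (- (norm (m - m'))\<^sup>2 / (4 * s\<^sup>2 + \<gamma>\<^sup>2))"
proof -
  define h where "h = \<gamma>\<^sup>2 + 2 * s\<^sup>2"
  have h: "0 < h" using assms by (simp add: h_def add_pos_pos)
  let ?\<mu> = "mean_embedding (gauss_kernel \<gamma>) \<iota> (gaussian s m)"
  have "?\<mu> \<bullet> mean_embedding (gauss_kernel \<gamma>) \<iota> (gaussian s m')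
      = (\<integral>x. ?\<mu> \<bullet> inv \<iota> (gauss_kernel \<gamma> x) \<partial>gaussian s m')"
    unfolding mean_embedding_def[of _ _ "gaussian s m'"]
    by (cases "?\<mu> = 0") (simp_all add: integrable_feature assms)
  also have "\<dots> = sqrt (\<gamma>\<^sup>2 / h) ^ CARD('d) * (\<integral>x. gauss_kernel (sqrt h) x m \<partial>gaussian s m')"
    by (simp add: mean_embedding_inner assms h_def)
  also have "\<dots> = (sqrt (\<gamma>\<^sup>2 / h) * sqrt (h / (h + 2 * s\<^sup>2))) ^ CARD('d)
      * exp (- (norm (m - m'))\<^sup>2 / (h + 2 * s\<^sup>2))"
    using h assms by (subst integral_gauss_kernel_gaussian) (simp_all add: gauss_kernel_def power_mult_distrib)
  also have "sqrt (\<gamma>\<^sup>2 / h) * sqrt (h / (h + 2 * s\<^sup>2)) = sqrt (\<gamma>\<^sup>2 / (\<gamma>\<^sup>2 + 4 * s\<^sup>2))"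
    using h by (simp add: h_def flip: real_sqrt_mult)
  also have "h + 2 * s\<^sup>2 = 4 * s\<^sup>2 + \<gamma>\<^sup>2" by (simp add: h_def)
  finally show ?thesis .
qed

text \<open>Expand the square; the diagonal terms are the inner product at equal means, where the
  exponential is 1.\<close>

lemma mmd_gaussian:
  assumes "0 < s" "0 < \<gamma>"
  shows "(mmd (gauss_kernel \<gamma>) \<iota> (gaussian s m) (gaussian s m'))\<^sup>2
    = 2 * sqrt (\<gamma>\<^sup>2 / (\<gamma>\<^sup>2 + 4 * s\<^sup>2)) ^ CARD('d) * (1 - exp (- (norm (m - m'))\<^sup>2 / (4 * s\<^sup>2 + \<gamma>\<^sup>2)))"
  unfolding mmd_def power2_norm_eq_inner inner_diff mean_embedding_inner_mean_embedding[OF assms]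
  by (simp add: norm_minus_commute[of m' m] algebra_simps)

text \<open>The kernel is positive, so the cross term only lowers the sum of two squared norms that
  are at most 1. The triangle inequality would give 2.\<close>

lemma norm_centred_feature_le:
  assumes "0 < s" "0 < \<gamma>"
  shows "norm (inv \<iota> (gauss_kernel \<gamma> x) - mean_embedding (gauss_kernel \<gamma>) \<iota> (gaussian s m)) \<le> sqrt 2"
proof (rule real_le_rsqrt)
  let ?\<mu> = "mean_embedding (gauss_kernel \<gamma>) \<iota> (gaussian s m)"
  have "0 \<le> ?\<mu> \<bullet> inv \<iota> (gauss_kernel \<gamma> x)"
    unfolding mean_embedding_inner[OF assms] by (simp add: gauss_kernel_def)
  moreover have "?\<mu> \<bullet> ?\<mu> \<le> 1"
    unfolding mean_embedding_inner_mean_embedding[OF assms]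
    using assms by (auto intro!: power_le_one simp: add_pos_pos)
  moreover have "inv \<iota> (gauss_kernel \<gamma> x) \<bullet> inv \<iota> (gauss_kernel \<gamma> x) = 1"
    by (simp add: norm_feature dot_square_norm)
  ultimately show "(norm (inv \<iota> (gauss_kernel \<gamma> x) - ?\<mu>))\<^sup>2 \<le> 2"
    by (simp add: power2_norm_eq_inner inner_diff inner_commute)
qed

lemma mean_embedding_empirical:
  assumes "1 \<le> n"
  shows "mean_embedding (gauss_kernel \<gamma>) \<iota> (empirical n x)
      = (1 / real n) *\<^sub>R (\<Sum>i=1..n. inv \<iota> (gauss_kernel \<gamma> (x i)))"
proof -
  have "x \<in> measurable (uniform_count_measure {1..n}) borel"
    by (auto simp: measurable_def sets_uniform_count_measure space_uniform_count_measure)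
  thus ?thesis unfolding mean_embedding_def empirical_def
    by (simp add: integral_distr uniform_count_measure_def lebesgue_integral_point_measure_finite
        scaleR_sum_right)
qed

end

section \<open>From an MMD deviation to a bound on the parameter error\<close>

text \<open>Take logarithms in \<open>1 - K \<le> exp (- u / a)\<close>; if
  \<open>1 - K \<le> 0\<close>, the right side is infinite since \<open>a\<close> is
  positive.\<close>

lemma le_neg_log:
  fixes a u K :: real
  assumes "0 < a" "1 - exp (- u / a) \<le> K"
  shows "ereal u \<le> ereal a * neg_log (1 - K)"
proof (cases "1 - K \<le> 0")
  case True
  thus ?thesis using assms by (simp add: neg_log_def)
next
  case False
  hence "ln (1 - K) \<le> ln (exp (- u / a))"
    using assms by (subst ln_le_cancel_iff) auto
  hence "u \<le> a * - ln (1 - K)" using assms by (simp add: field_simps)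
  thus ?thesis using False by (simp add: neg_log_def)
qed

text \<open>Since \<open>norm (k(x,\<cdot>) - k(y,\<cdot>)) \<le> sqrt 2\<close>, contamination moves the empirical embedding by at
  most \<open>\<epsilon> * sqrt 2\<close>. The constant of the theorem leaves room for \<open>2 * \<epsilon>\<close> here, and for a
  deviation twice as large as the one given by McDiarmid's inequality.\<close>

lemma mmd_estimate_error:
  fixes \<theta>0 \<theta> :: "real ^ 'd" and x y :: "nat \<Rightarrow> real ^ 'd"
    and \<iota> :: "'h::{real_inner, banach, second_countable_topology} \<Rightarrow> real ^ 'd \<Rightarrow> real"
  assumes rkhs: "is_rkhs (gauss_kernel \<gamma>) \<iota>" and "0 < s" "0 < \<gamma>" "1 \<le> n"
    and Out: "Out \<subseteq> {1..n}" "real (card Out) \<le> \<epsilon> * real n" "\<And>i. i \<in> {1..n} - Out \<Longrightarrow> y i = x i"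
    and est: "is_mmd_estimate (gauss_kernel \<gamma>) \<iota> (gaussian s) UNIV n y \<theta>"
    and dev: "mmd (gauss_kernel \<gamma>) \<iota> (empirical n x) (gaussian s \<theta>0) \<le> 2 * r"
  shows "1 - exp (- (norm (\<theta> - \<theta>0))\<^sup>2 / (4 * s\<^sup>2 + \<gamma>\<^sup>2))
    \<le> 8 * exp (2 * s\<^sup>2 * real CARD('d) / \<gamma>\<^sup>2) * (\<epsilon> + r)\<^sup>2"
proof -
  let ?k = "gauss_kernel \<gamma> :: real ^ 'd \<Rightarrow> real ^ 'd \<Rightarrow> real"
  let ?\<phi> = "\<lambda>z. inv \<iota> (?k z)"
  let ?D = "mmd ?k \<iota>"
  let ?c = "sqrt (\<gamma>\<^sup>2 / (\<gamma>\<^sup>2 + 4 * s\<^sup>2)) ^ CARD('d)"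
  let ?e = "1 - exp (- (norm (\<theta> - \<theta>0))\<^sup>2 / (4 * s\<^sup>2 + \<gamma>\<^sup>2))"
  have n: "0 < real n" using assms by simp
  have "(\<Sum>i=1..n. ?\<phi> (y i)) - (\<Sum>i=1..n. ?\<phi> (x i)) = (\<Sum>i=1..n. ?\<phi> (y i) - ?\<phi> (x i))"
    by (simp add: sum_subtractf)
  \<comment> \<open>Terms outside \<open>Out\<close> vanish, since the two samples agree
    there.\<close>
  also have "\<dots> = (\<Sum>i\<in>Out. ?\<phi> (y i) - ?\<phi> (x i))"
    using Out by (intro sum.mono_neutral_right) auto
  also have "norm \<dots> \<le> (\<Sum>i\<in>Out. 2)"
  proof (rule sum_norm_le)
    fix i
    show "norm (?\<phi> (y i) - ?\<phi> (x i)) \<le> 2"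
      using norm_triangle_ineq4[of "?\<phi> (y i)" "?\<phi> (x i)"] by (simp add: norm_feature[OF rkhs])
  qed
  also have "\<dots> \<le> 2 * \<epsilon> * real n" using Out by simp
  finally have "norm ((1 / real n) *\<^sub>R ((\<Sum>i=1..n. ?\<phi> (y i)) - (\<Sum>i=1..n. ?\<phi> (x i)))) \<le> 2 * \<epsilon>"
    using n by (simp only: norm_scaleR) (simp add: field_simps)
  hence contam: "?D (empirical n y) (empirical n x) \<le> 2 * \<epsilon>"
    unfolding mmd_def mean_embedding_empirical[OF rkhs \<open>1 \<le> n\<close>] by (simp add: scaleR_diff_right)
  have tri: "?D P R \<le> ?D P Q + ?D Q R" for P Q R
    unfolding mmd_def using norm_triangle_ineq[of "mean_embedding ?k \<iota> P - mean_embedding ?k \<iota> Q"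
        "mean_embedding ?k \<iota> Q - mean_embedding ?k \<iota> R"] by simp
  have comm: "?D P Q = ?D Q P" for P Q by (simp add: mmd_def norm_minus_commute)
  have min: "?D (gaussian s \<theta>) (empirical n y) \<le> ?D (gaussian s \<theta>0) (empirical n y)"
    using est by (force simp: is_mmd_estimate_def is_arg_min_def not_less)
  have "?D (gaussian s \<theta>) (gaussian s \<theta>0) \<le> 2 * ?D (empirical n y) (gaussian s \<theta>0)"
    using tri[of "gaussian s \<theta>" "gaussian s \<theta>0" "empirical n y"] min
    by (simp add: comm[of "gaussian s \<theta>0"])
  also have "\<dots> \<le> 4 * (\<epsilon> + r)"
    using tri[of "empirical n y" "gaussian s \<theta>0" "empirical n x"] contam dev by simp
  finally have "(?D (gaussian s \<theta>) (gaussian s \<theta>0))\<^sup>2 \<le> (4 * (\<epsilon> + r))\<^sup>2"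
    by (intro power_mono) (auto simp: mmd_def)
  \<comment> \<open>The square contributes 16, and the factor 2 in the closed form of the squared
    MMD reduces it to 8.\<close>
  hence 1: "?c * ?e \<le> 8 * (\<epsilon> + r)\<^sup>2"
    unfolding mmd_gaussian[OF rkhs \<open>0 < s\<close> \<open>0 < \<gamma>\<close>]
    by (simp add: power_mult_distrib del: distrib_left_numeral)
  \<comment> \<open>Apply \<open>1 + u \<le> exp u\<close> at
    \<open>u = 4 * s\<^sup>2 / \<gamma>\<^sup>2\<close>, take a square root, then raise to the power
    of the dimension.\<close>
  have 2: "1 \<le> exp (2 * s\<^sup>2 * real CARD('d) / \<gamma>\<^sup>2) * ?c"
  proof -
    have "(\<gamma>\<^sup>2 + 4 * s\<^sup>2) / \<gamma>\<^sup>2 = 1 + 4 * s\<^sup>2 / \<gamma>\<^sup>2" using assms by (simp add: field_simps)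
    also have "\<dots> \<le> exp (4 * s\<^sup>2 / \<gamma>\<^sup>2)" by (rule exp_ge_add_one_self)
    also have "\<dots> = (exp (2 * s\<^sup>2 / \<gamma>\<^sup>2))\<^sup>2" by (simp flip: exp_double)
    finally have "sqrt ((\<gamma>\<^sup>2 + 4 * s\<^sup>2) / \<gamma>\<^sup>2) \<le> exp (2 * s\<^sup>2 / \<gamma>\<^sup>2)"
      by (intro real_le_lsqrt) auto
    moreover have "0 < \<gamma>\<^sup>2 + 4 * s\<^sup>2" using assms by (simp add: add_pos_pos)
    ultimately have "1 \<le> exp (2 * s\<^sup>2 / \<gamma>\<^sup>2) * sqrt (\<gamma>\<^sup>2 / (\<gamma>\<^sup>2 + 4 * s\<^sup>2))"
      using assms by (simp add: real_sqrt_divide field_simps)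
    hence "1 \<le> (exp (2 * s\<^sup>2 / \<gamma>\<^sup>2) * sqrt (\<gamma>\<^sup>2 / (\<gamma>\<^sup>2 + 4 * s\<^sup>2))) ^ CARD('d)"
      by (rule one_le_power)
    thus ?thesis by (simp add: power_mult_distrib mult_ac flip: exp_of_nat_mult)
  qed
  have "0 \<le> ?e" using assms by (auto intro!: divide_nonpos_nonneg)
  hence "?e \<le> exp (2 * s\<^sup>2 * real CARD('d) / \<gamma>\<^sup>2) * ?c * ?e"
    using mult_right_mono[OF 2] by simp
  also have "\<dots> \<le> exp (2 * s\<^sup>2 * real CARD('d) / \<gamma>\<^sup>2) * (8 * (\<epsilon> + r)\<^sup>2)"
    using 1 by (simp add: mult.assoc)
  finally show ?thesis by (simp add: mult_ac)
qed

section \<open>Concentration of the empirical embedding\<close>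

text \<open>Hoeffding's inequality for the centred features, bounded by \<open>sqrt 2\<close>, at
  level \<open>t = 2 * n * r\<close>; the exponent is then exactly
  \<open>- (n * r\<^sup>2)\<close>.\<close>

lemma (in prob_space) empirical_mmd_deviation:
  fixes X :: "nat \<Rightarrow> 'a \<Rightarrow> real ^ 'd" and \<theta> :: "real ^ 'd"
    and \<iota> :: "'h::{real_inner, banach, second_countable_topology} \<Rightarrow> real ^ 'd \<Rightarrow> real"
  assumes rkhs: "is_rkhs (gauss_kernel \<gamma>) \<iota>" and "0 < s" "0 < \<gamma>" "1 \<le> n" "0 < \<delta>" "\<delta> < 1"
    and X: "indep_vars (\<lambda>_. borel) X {1..n}"
    and distr: "\<And>i. i \<in> {1..n} \<Longrightarrow> distr M borel (X i) = gaussian s \<theta>"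
  shows "\<exists>A\<in>sets M. prob A \<ge> 1 - \<delta> \<and> (\<forall>\<omega>\<in>A. mmd (gauss_kernel \<gamma>) \<iota> (empirical n (\<lambda>i. X i \<omega>)) (gaussian s \<theta>)
      \<le> 2 * ((1 + sqrt (2 * ln (1 / \<delta>))) / sqrt (real n)))"
proof -
  let ?\<mu> = "mean_embedding (gauss_kernel \<gamma>) \<iota> (gaussian s \<theta>)"
  define f where "f x = inv \<iota> (gauss_kernel \<gamma> x) - ?\<mu>" for x
  define L where "L = ln (1 / \<delta>)"
  define r where "r = (1 + sqrt (2 * L)) / sqrt (real n)"
  define t where "t = 2 * real n * r"
  define B where "B = {\<omega>\<in>space M. t \<le> norm (\<Sum>i=1..n. f (X i \<omega>))}"
  have n: "0 < real n" using assms by simp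
  have L: "0 < L" using assms by (simp add: L_def)
  have r: "0 < r" using n L by (simp add: r_def add_pos_nonneg)
  have fm[measurable]: "f \<in> borel_measurable borel"
    unfolding f_def using borel_measurable_feature[OF rkhs] by measurable
  have Xm[measurable]: "X i \<in> borel_measurable M" if "i \<in> {1..n}" for i
    using X that by (auto simp: indep_vars_def)
  have [measurable]: "(\<lambda>\<omega>. f (X i \<omega>)) \<in> borel_measurable M" if "i \<in> {1..n}" for i
    using Xm[OF that] fm by (rule measurable_compose)
  interpret G: prob_space "gaussian s \<theta>" using \<open>0 < s\<close> by (rule prob_space_gaussian)
  have "integral\<^sup>L (gaussian s \<theta>) f = 0"
    unfolding f_def using integrable_feature[OF rkhs \<open>0 < s\<close>]
    by (subst Bochner_Integration.integral_diff) (auto simp: mean_embedding_def G.prob_space[simplified])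
  hence "prob B \<le> 2 * exp (- t\<^sup>2 / (2 * real (card {1..n}) * (sqrt 2)\<^sup>2))"
    unfolding B_def using n r \<open>1 \<le> n\<close> norm_centred_feature_le[OF rkhs \<open>0 < s\<close> \<open>0 < \<gamma>\<close>]
    by (intro Hilbert_space_Hoeffding[OF _ _ X distr fm]) (auto simp: f_def t_def)
  also have "- t\<^sup>2 / (2 * real (card {1..n}) * (sqrt 2)\<^sup>2) = - (real n * r\<^sup>2)"
    using n by (simp add: t_def power2_eq_square)
  also have "real n * r\<^sup>2 = (1 + sqrt (2 * L))\<^sup>2"
    using n by (simp add: r_def power_divide)
  \<comment> \<open>Expanding the square leaves more than \<open>1 + L\<close>; the \<open>1\<close>
    is kept because \<open>2 \<le> exp 1\<close> lets it absorb the factor 2.\<close>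
  also have "2 * exp (- (1 + sqrt (2 * L))\<^sup>2) \<le> 2 * exp (- 1 - L)"
  proof -
    have "(1 + sqrt (2 * L))\<^sup>2 = 1 + 2 * L + 2 * sqrt (2 * L)"
      using L by (simp add: power2_sum)
    moreover have "0 \<le> sqrt (2 * L)" using L by simp
    ultimately have "- (1 + sqrt (2 * L))\<^sup>2 \<le> - 1 - L" using L by linarith
    thus ?thesis by simp
  qed
  also have "2 * exp (- 1 - L) \<le> exp (- L)"
    using exp_ge_add_one_self[of 1] by (simp add: exp_diff exp_minus field_simps)
  also have "exp (- L) = \<delta>"
    using assms by (simp add: L_def ln_div)
  finally have B: "prob B \<le> \<delta>" .
  have Bs: "B \<in> sets M" unfolding B_def by measurable
  show ?thesis
  proof (intro bexI[of _ "space M - B"] conjI ballI)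
    show "prob (space M - B) \<ge> 1 - \<delta>" using B Bs by (simp add: prob_compl)
    show "space M - B \<in> sets M" using Bs by auto
    fix \<omega>
    assume "\<omega> \<in> space M - B"
    hence "norm (\<Sum>i=1..n. f (X i \<omega>)) \<le> 2 * real n * r" by (auto simp: B_def t_def)
    moreover have "mean_embedding (gauss_kernel \<gamma>) \<iota> (empirical n (\<lambda>i. X i \<omega>)) - ?\<mu>
        = (1 / real n) *\<^sub>R (\<Sum>i=1..n. f (X i \<omega>))"
      unfolding mean_embedding_empirical[OF rkhs \<open>1 \<le> n\<close>] using n
      by (simp add: f_def sum_subtractf scaleR_diff_right sum_constant_scaleR)
    ultimately have "mmd (gauss_kernel \<gamma>) \<iota> (empirical n (\<lambda>i. X i \<omega>)) (gaussian s \<theta>) \<le> 2 * r"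
      using n unfolding mmd_def by (simp add: field_simps)
    thus "mmd (gauss_kernel \<gamma>) \<iota> (empirical n (\<lambda>i. X i \<omega>)) (gaussian s \<theta>)
        \<le> 2 * ((1 + sqrt (2 * ln (1 / \<delta>))) / sqrt (real n))"
      by (simp only: r_def L_def)
  qed
qed

text \<open>\<open>Out\<close> depends on the outcome, so the adversary may choose it after seeing
  the whole sample. The bound is asserted on a measurable event \<open>A\<close>, since the set of
  all outcomes satisfying it need not be measurable.\<close>

theorem proposition4p1:
  fixes M :: "'w measure"
    and X Xt :: "nat \<Rightarrow> 'w \<Rightarrow> real ^ 'd"
    and Out :: "'w \<Rightarrow> nat set"
    and \<theta>t :: "'w \<Rightarrow> real ^ 'd"
    and \<theta>0 :: "real ^ 'd"
    and \<iota> :: "'h::{real_inner, banach, second_countable_topology} \<Rightarrow> real ^ 'd \<Rightarrow> real"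
    and n :: nat and \<sigma> \<gamma> \<epsilon> \<delta> :: real
  assumes "prob_space M"
    and "n \<ge> 1" and "\<sigma> > 0" and "\<gamma> > 0"
    and "prob_space.indep_vars M (\<lambda>_. borel) X {1..n}"
    and "\<And>i. i \<in> {1..n} \<Longrightarrow> distr M borel (X i) = gaussian \<sigma> \<theta>0"
    and "\<And>\<omega>. \<omega> \<in> space M \<Longrightarrow> Out \<omega> \<subseteq> {1..n} \<and> real (card (Out \<omega>)) \<le> \<epsilon> * real n"
    and "\<And>\<omega> i. \<omega> \<in> space M \<Longrightarrow> i \<in> {1..n} - Out \<omega> \<Longrightarrow> Xt i \<omega> = X i \<omega>"
    and "is_rkhs (gauss_kernel \<gamma>) \<iota>"
    and "\<And>\<omega>. \<omega> \<in> space M \<Longrightarrow>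
           is_mmd_estimate (gauss_kernel \<gamma>) \<iota> (gaussian \<sigma>) UNIV n (\<lambda>i. Xt i \<omega>) (\<theta>t \<omega>)"
    and "0 < \<delta>" and "\<delta> < 1"
  shows "(\<exists>A\<in>sets M. measure M A \<ge> 1 - \<delta> \<and>
           (\<forall>\<omega>\<in>A. ereal ((norm (\<theta>t \<omega> - \<theta>0))\<^sup>2)
              \<le> ereal (4 * \<sigma>\<^sup>2 + \<gamma>\<^sup>2) *
                 neg_log (1 - 8 * exp (2 * \<sigma>\<^sup>2 * real CARD('d) / \<gamma>\<^sup>2)
                   * (\<epsilon> + (1 + sqrt (2 * ln (1 / \<delta>))) / sqrt (real n))\<^sup>2)))
    \<and> (\<gamma> = \<sigma> * sqrt (2 * real CARD('d)) \<longrightarrow>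
         (\<exists>A\<in>sets M. measure M A \<ge> 1 - \<delta> \<and>
           (\<forall>\<omega>\<in>A. ereal ((norm (\<theta>t \<omega> - \<theta>0))\<^sup>2)
              \<le> ereal (2 * \<sigma>\<^sup>2 * (real CARD('d) + 2)) *
                 neg_log (1 - 8 * exp 1
                   * (\<epsilon> + (1 + sqrt (2 * ln (1 / \<delta>))) / sqrt (real n))\<^sup>2))))"
proof -
  interpret prob_space M by fact
  define K where "K = 8 * exp (2 * \<sigma>\<^sup>2 * real CARD('d) / \<gamma>\<^sup>2)
      * (\<epsilon> + (1 + sqrt (2 * ln (1 / \<delta>))) / sqrt (real n))\<^sup>2"
  obtain A where A: "A \<in> sets M" "prob A \<ge> 1 - \<delta>" and dev: "\<And>\<omega>. \<omega> \<in> A \<Longrightarrow>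
      mmd (gauss_kernel \<gamma>) \<iota> (empirical n (\<lambda>i. X i \<omega>)) (gaussian \<sigma> \<theta>0)
      \<le> 2 * ((1 + sqrt (2 * ln (1 / \<delta>))) / sqrt (real n))"
    using empirical_mmd_deviation[OF assms(9,3,4,2,11,12,5,6)] by blast
  have bound: "ereal ((norm (\<theta>t \<omega> - \<theta>0))\<^sup>2) \<le> ereal (4 * \<sigma>\<^sup>2 + \<gamma>\<^sup>2) * neg_log (1 - K)"
    if "\<omega> \<in> A" for \<omega>
  proof (rule le_neg_log)
    have \<omega>: "\<omega> \<in> space M" using A that sets.sets_into_space by blast
    show "0 < 4 * \<sigma>\<^sup>2 + \<gamma>\<^sup>2" using assms(3,4) by (simp add: add_pos_pos)
    show "1 - exp (- (norm (\<theta>t \<omega> - \<theta>0))\<^sup>2 / (4 * \<sigma>\<^sup>2 + \<gamma>\<^sup>2)) \<le> K"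
      unfolding K_def using assms(7,8)[OF \<omega>]
      by (intro mmd_estimate_error[where Out = "Out \<omega>",
            OF assms(9,3,4,2) _ _ _ assms(10)[OF \<omega>] dev[OF that]]) auto
  qed
  \<comment> \<open>With this bandwidth \<open>\<gamma>\<^sup>2 = 2 * d * \<sigma>\<^sup>2\<close>,
    where \<open>d\<close> is the dimension, so the second claim is the first one rewritten, on the
    same event.\<close>
  have special: "4 * \<sigma>\<^sup>2 + \<gamma>\<^sup>2 = 2 * \<sigma>\<^sup>2 * (real CARD('d) + 2)"
      "2 * \<sigma>\<^sup>2 * real CARD('d) / \<gamma>\<^sup>2 = 1" if "\<gamma> = \<sigma> * sqrt (2 * real CARD('d))"
    using assms(3) unfolding that by (simp_all add: power_mult_distrib distrib_left)
  show ?thesis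
  proof (intro conjI impI)
    assume \<gamma>: "\<gamma> = \<sigma> * sqrt (2 * real CARD('d))"
    show "\<exists>A\<in>sets M. measure M A \<ge> 1 - \<delta> \<and>
           (\<forall>\<omega>\<in>A. ereal ((norm (\<theta>t \<omega> - \<theta>0))\<^sup>2)
              \<le> ereal (2 * \<sigma>\<^sup>2 * (real CARD('d) + 2)) *
                 neg_log (1 - 8 * exp 1
                   * (\<epsilon> + (1 + sqrt (2 * ln (1 / \<delta>))) / sqrt (real n))\<^sup>2))"
      using A bound unfolding K_def special[OF \<gamma>] by blast
  qed (use A bound in \<open>unfold K_def, blast\<close>)
qed

end
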